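(* Let $t,u$ be positive integers. Then there exist $\alpha=\alpha(t,u)>0$ and $\beta=\beta(u)>0$ (the latter depending only on $u$) such that for every positive integer $n$, $$R_{t,u}(n)\leq \alpha n^{\beta}.$$
   Context: A function $f:\mathbb{R}^{m}\to\mathbb{R}$ is linear if $f(\mathbf{x})=b+\sum_{i=1}^m a_i\mathbf{x}(i)$ for some reals $a_1,\dots,a_m,b$. A finite simple graph $G$ is semilinear* of complexity $(t,u)$ if $V(G)\subset\mathbb{R}^d$ for some positive integer $d$ and there are $tu$ linear functions $f_{i,j}:\mathbb{R}^d\times\mathbb{R}^d\to\mathbb{R}$, $(i,j)\in[u]\times[t]$, such that for distinct $\mathbf{x},\mathbf{y}\in V(G)$, $\{\mathbf{x},\mathbf{y}\}$ is an edge iff $\bigvee_{i\in[u]}\bigwedge_{j\in[t]}\{f_{i,j}(\mathbf{x},\mathbf{y})<0\}$ is true; it is assumed that this truth value is unchanged when $\mathbf{x}$ and $\mathbf{y}$ are swapped. $R_{t,u}(n)$ denotes the smallest $N$ such that every semilinear* graph of complexity $(t,u)$ on $N$ vertices contains a clique or an independent set of size $n$. *)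

theory Defs
  imports Complex_Main
begin

text \<open>Points of R^d are represented as functions nat => real vanishing at all
coordinates k >= d. A linear function f on R^d x R^d is given by 2d+1 reals:
f(x,y) = b + sum_{k<d} a k * x k + sum_{k<d} a (d+k) * y k.
The tu linear functions f_{i,j}, (i,j) in [u] x [t], are indexed 0-based by
i < u, j < t, with coefficients A i j and constant terms B i j.\<close>

definition lin_fun :: "nat \<Rightarrow> (nat \<Rightarrow> real) \<Rightarrow> real \<Rightarrow> (nat \<Rightarrow> real) \<Rightarrow> (nat \<Rightarrow> real) \<Rightarrow> real" where
  "lin_fun d a b x y = b + (\<Sum>k<d. a k * x k) + (\<Sum>k<d. a (d + k) * y k)"

definition sl_formula ::
  "nat \<Rightarrow> nat \<Rightarrow> nat \<Rightarrow> (nat \<Rightarrow> nat \<Rightarrow> nat \<Rightarrow> real) \<Rightarrow> (nat \<Rightarrow> nat \<Rightarrow> real)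
     \<Rightarrow> (nat \<Rightarrow> real) \<Rightarrow> (nat \<Rightarrow> real) \<Rightarrow> bool" where
  "sl_formula t u d A B x y = (\<exists>i<u. \<forall>j<t. lin_fun d (A i j) (B i j) x y < 0)"

definition semilinear_graph ::
  "nat \<Rightarrow> nat \<Rightarrow> nat \<Rightarrow> (nat \<Rightarrow> real) set \<Rightarrow> (nat \<Rightarrow> nat \<Rightarrow> nat \<Rightarrow> real) \<Rightarrow> (nat \<Rightarrow> nat \<Rightarrow> real) \<Rightarrow> bool" where
  "semilinear_graph t u d V A B \<longleftrightarrow>
     0 < d \<and> finite V \<and> (\<forall>x\<in>V. \<forall>k\<ge>d. x k = 0) \<and>
     (\<forall>x\<in>V. \<forall>y\<in>V. x \<noteq> y \<longrightarrow> (sl_formula t u d A B x y \<longleftrightarrow> sl_formula t u d A B y x))"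

definition sl_edge ::
  "nat \<Rightarrow> nat \<Rightarrow> nat \<Rightarrow> (nat \<Rightarrow> nat \<Rightarrow> nat \<Rightarrow> real) \<Rightarrow> (nat \<Rightarrow> nat \<Rightarrow> real)
     \<Rightarrow> (nat \<Rightarrow> real) \<Rightarrow> (nat \<Rightarrow> real) \<Rightarrow> bool" where
  "sl_edge t u d A B x y \<longleftrightarrow> x \<noteq> y \<and> sl_formula t u d A B x y"

definition has_clique_or_indep ::
  "nat \<Rightarrow> (('a \<Rightarrow> 'a \<Rightarrow> bool)) \<Rightarrow> 'a set \<Rightarrow> bool" where
  "has_clique_or_indep n E V \<longleftrightarrow>
     (\<exists>S\<subseteq>V. card S = n \<and>
        ((\<forall>x\<in>S. \<forall>y\<in>S. x \<noteq> y \<longrightarrow> E x y) \<or> (\<forall>x\<in>S. \<forall>y\<in>S. x \<noteq> y \<longrightarrow> \<not> E x y)))"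

definition R_sl :: "nat \<Rightarrow> nat \<Rightarrow> nat \<Rightarrow> nat" where
  "R_sl t u n = (LEAST N. \<forall>d V A B. semilinear_graph t u d V A B \<and> card V = N
                   \<longrightarrow> has_clique_or_indep n (sl_edge t u d A B) V)"

end

theory Submission
  imports Defs
begin

text \<open>Each atomic formula has the form \<open>f x < g y\<close>. Restricted to the vertices with
\<open>g x \<le> f x\<close> this relation is transitive. The other vertices carry the intervals
\<open>[f x, g x]\<close>; splitting them recursively at a median sorts them into logarithmically many
levels, and within one level \<open>f x < g y\<close> is again transitive. By pigeonhole a set \<open>W\<close> of
\<open>N / (log N) ^ O(tu)\<close> vertices remains on which all atoms, hence all \<open>u\<close> conjunctions, are
transitive. A chain of such a conjunction is a clique, because the edge relation is symmetric,
so if there is no clique of size \<open>n\<close>, applying Mirsky's theorem \<open>u\<close> times gives an independent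
set of size at least \<open>card W / n ^ u\<close>. The logarithmic factor is absorbed by doubling the
exponent \<open>u + 1\<close>, at the price of a constant depending on \<open>t\<close>.\<close>

section \<open>Interval levels and large subsets on which atoms are transitive\<close>

lemma ex_median:
  fixes b :: "'a \<Rightarrow> 'b::linorder"
  assumes fin: "finite V" and ne: "V \<noteq> {}" and card: "card V < 2 * m"
  obtains p where "card {x\<in>V. b x < p} < m" "card {x\<in>V. p < b x} < m"
proof -
  have m: "0 < m" using card by simp
  \<comment> \<open>The median is the least value attained on \<open>Q\<close>. By the definition of
    \<open>Q\<close> fewer than \<open>m\<close> points lie above it.\<close>
  define Q where "Q = {x\<in>V. card {y\<in>V. b x < b y} < m}"
  have finQ: "finite Q" using fin by (simp add: Q_def)
  have top: "b ` V \<noteq> {}" "finite (b ` V)" using fin ne by auto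
  obtain z where z: "z \<in> V" "b z = Max (b ` V)"
    using Max_in[OF top(2,1)] by auto
  have none: "{y\<in>V. b z < b y} = {}"
    using z top by (auto simp: not_less)
  have "z \<in> Q" using z(1) m unfolding Q_def mem_Collect_eq none by simp
  then have Qne: "b ` Q \<noteq> {}" by auto
  obtain w where w: "w \<in> Q" "b w = Min (b ` Q)"
    using Min_in[OF finite_imageI[OF finQ] Qne] by (metis imageE)
  have "card {x\<in>V. b x < b w} < m"
  proof (cases "{x\<in>V. b x < b w} = {}")
    case True
    then show ?thesis using m by (metis card.empty)
  next
    case False
    let ?L = "{x\<in>V. b x < b w}"
    have finL: "finite (b ` ?L)" using fin by simp
    obtain l where l: "l \<in> ?L" "b l = Max (b ` ?L)"
      using Max_in[OF finL] False by (metis (no_types, lifting) imageE image_is_empty)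
    have max: "b x \<le> b l" if "x \<in> ?L" for x
      using Max_ge[OF finL] that l(2) by simp
    \<comment> \<open>The largest value below the median is not attained in \<open>Q\<close>, so at
      least \<open>m\<close> points exceed it. These are disjoint from \<open>?L\<close>, which
      leaves \<open>?L\<close> fewer than \<open>2 * m - m\<close> points.\<close>
    have "l \<notin> Q"
    proof
      assume "l \<in> Q"
      then have "b w \<le> b l" using w finQ by simp
      then show False using l(1) by auto
    qed
    then have "m \<le> card {y\<in>V. b l < b y}"
      using l(1) by (simp add: Q_def)
    moreover have "card ?L + card {y\<in>V. b l < b y} = card (?L \<union> {y\<in>V. b l < b y})"
      by (intro card_Un_disjoint[symmetric]) (use fin max in force)+
    moreover have "\<dots> \<le> card V"
      by (intro card_mono) (use fin in auto)
    ultimately show ?thesis using card by linarith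
  qed
  moreover have "card {x\<in>V. b w < b x} < m" using w by (simp add: Q_def)
  ultimately show thesis by (rule that)
qed

text \<open>Split at a median \<open>p\<close> of the right endpoints. Intervals with
  \<open>f x < p \<le> g x\<close> are pairwise related and receive the new level \<open>k\<close>.
  Those in \<open>L\<close> (ending before \<open>p\<close>) and those in \<open>R\<close> (starting
  at or after \<open>p\<close>) are fewer than \<open>2 ^ k\<close> each and can share the levels
  below \<open>k\<close>: every pair from \<open>L\<close> to \<open>R\<close> is related, none from
  \<open>R\<close> to \<open>L\<close>.\<close>

lemma interval_levels:
  fixes f g :: "'a \<Rightarrow> 'b::linorder"
  assumes "finite V" "card V < 2 ^ k" "\<And>x. x \<in> V \<Longrightarrow> f x < g x"
  shows "\<exists>c::'a \<Rightarrow> nat. (\<forall>x\<in>V. c x < k) \<and>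
           (\<forall>l. transp_on {x\<in>V. c x = l} (\<lambda>x y. f x < g y))"
  using assms
proof (induction k arbitrary: V)
  case 0
  then show ?case by (auto intro!: transp_onI)
next
  case (Suc k)
  show ?case
  proof (cases "V = {}")
    case True
    then show ?thesis by (auto intro!: transp_onI)
  next
    case False
    obtain p where p: "card {x\<in>V. g x < p} < 2 ^ k" "card {x\<in>V. p < g x} < 2 ^ k"
      using ex_median[of V "2 ^ k" g] Suc.prems False by auto
    define L where "L = {x\<in>V. g x < p}"
    define R where "R = {x\<in>V. p \<le> f x}"
    \<comment> \<open>The median controls right endpoints only; \<open>f x < g x\<close> transfers
      its bound to the left endpoints that define \<open>R\<close>.\<close>
    have "R \<subseteq> {x\<in>V. p < g x}"
      using Suc.prems(3) by (force simp: R_def)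
    then have "card R \<le> card {x\<in>V. p < g x}"
      using Suc.prems(1) by (intro card_mono) auto
    then have cardR: "card R < 2 ^ k" using p by simp
    have cardL: "card L < 2 ^ k" using p by (simp add: L_def)
    have sub: "L \<subseteq> V" "R \<subseteq> V" by (auto simp: L_def R_def)
    have fin: "finite L" "finite R" using sub Suc.prems(1) finite_subset by auto
    obtain cL :: "'a \<Rightarrow> nat" where cL: "\<And>x. x \<in> L \<Longrightarrow> cL x < k"
        "\<And>l. transp_on {x\<in>L. cL x = l} (\<lambda>x y. f x < g y)"
      using Suc.IH[OF fin(1) cardL] Suc.prems(3) sub by blast
    obtain cR :: "'a \<Rightarrow> nat" where cR: "\<And>x. x \<in> R \<Longrightarrow> cR x < k"
        "\<And>l. transp_on {x\<in>R. cR x = l} (\<lambda>x y. f x < g y)"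
      using Suc.IH[OF fin(2) cardR] Suc.prems(3) sub by blast
    have RL: "\<not> f x < g y" if "x \<in> R" "y \<in> L" for x y
      using that by (auto simp: L_def R_def)
    have LR: "f x < g y" if "x \<in> L" "y \<in> R" for x y
    proof -
      have "f x < g x" "f y < g y" using that sub Suc.prems(3) by auto
      then show ?thesis using that by (auto simp: L_def R_def)
    qed
    have MM: "f x < g y" if "x \<in> V - L - R" "y \<in> V - L - R" for x y
      using that by (auto simp: L_def R_def)
    have disj: "x \<notin> R" if "x \<in> L" for x
      using that Suc.prems(3)[of x] by (auto simp: L_def R_def)
    define c where "c x = (if x \<in> L then cL x else if x \<in> R then cR x else k)" for x
    have "transp_on {x\<in>V. c x = l} (\<lambda>x y. f x < g y)" for l
    proof (rule transp_onI)
      fix x y z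
      assume mem: "x \<in> {x\<in>V. c x = l}" "y \<in> {x\<in>V. c x = l}" "z \<in> {x\<in>V. c x = l}"
        and xy: "f x < g y" and yz: "f y < g z"
      show "f x < g z"
      proof (cases "l = k")
        case True
        then have "x \<in> V - L - R" "z \<in> V - L - R"
          using mem cL(1) cR(1) by (auto simp: c_def split: if_splits)
        then show ?thesis by (rule MM)
      next
        case False
        then have LorR: "x \<in> L \<or> x \<in> R" "y \<in> L \<or> y \<in> R" "z \<in> L \<or> z \<in> R"
          using mem by (auto simp: c_def split: if_splits)
        \<comment> \<open>As \<open>R\<close> is never left, a path \<open>x\<close>,
          \<open>y\<close>, \<open>z\<close> either starts in \<open>L\<close> and ends in
          \<open>R\<close>, or stays on one side.\<close>
        then consider "x \<in> L" "z \<in> R" | "x \<in> L" "y \<in> L" "z \<in> L" | "x \<in> R" "y \<in> R" "z \<in> R"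
          using RL xy yz by blast
        then show ?thesis
        proof cases
          case 1
          then show ?thesis by (rule LR)
        next
          case 2
          then show ?thesis
            using mem transp_onD[OF cL(2)[of l], of x y z] xy yz by (simp add: c_def)
        next
          case 3
          moreover have "x \<notin> L" "y \<notin> L" "z \<notin> L" using 3 disj by blast+
          ultimately show ?thesis
            using mem transp_onD[OF cR(2)[of l], of x y z] xy yz by (simp add: c_def)
        qed
      qed
    qed
    moreover have "\<forall>x\<in>V. c x < Suc k"
      using cL(1) cR(1) by (auto simp: c_def less_Suc_eq)
    ultimately show ?thesis by blast
  qed
qed

text \<open>Pigeonhole over \<open>k + 1\<close> classes: the \<open>k\<close> interval levels, and
  one more for the vertices with \<open>g x \<le> f x\<close>, labelled \<open>k\<close> because
  levels are below \<open>k\<close>.\<close>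

lemma ex_large_transp_on_subset:
  fixes f g :: "'a \<Rightarrow> 'b::linorder"
  assumes fin: "finite V" and card: "card V < 2 ^ k"
  shows "\<exists>W\<subseteq>V. card V \<le> (k + 1) * card W \<and> transp_on W (\<lambda>x y. f x < g y)"
proof -
  define P where "P = {x\<in>V. f x < g x}"
  have "card P \<le> card V" using fin by (intro card_mono) (auto simp: P_def)
  then have "card P < 2 ^ k" using card by linarith
  moreover have "finite P" "\<And>x. x \<in> P \<Longrightarrow> f x < g x" using fin by (auto simp: P_def)
  ultimately obtain c where c: "\<And>x. x \<in> P \<Longrightarrow> c x < k"
      "\<And>l. transp_on {x\<in>P. c x = l} (\<lambda>x y. f x < g y)"
    using interval_levels[of P k f g] by blast
  define c' where "c' x = (if x \<in> P then c x else k)" for x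
  have tr: "transp_on {x\<in>V. c' x = l} (\<lambda>x y. f x < g y)" for l
  proof (cases "l = k")
    case True
    then have "{x\<in>V. c' x = l} \<subseteq> {x\<in>V. g x \<le> f x}"
      using c(1) by (auto simp: c'_def P_def split: if_splits) force
    \<comment> \<open>The chain is \<open>f x < g y \<le> f y < g z\<close>.\<close>
    moreover have "transp_on {x\<in>V. g x \<le> f x} (\<lambda>x y. f x < g y)"
      by (rule transp_onI) force
    ultimately show ?thesis by (rule transp_on_subset[rotated])
  next
    case False
    then have "{x\<in>V. c' x = l} \<subseteq> {x\<in>P. c x = l}"
      by (auto simp: c'_def P_def split: if_splits)
    then show ?thesis using c(2) transp_on_subset by blast
  qed
  show ?thesis
  proof (rule ccontr)
    assume "\<not> ?thesis"
    then have small: "(k + 1) * card {x\<in>V. c' x = l} < card V" for l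
      using tr[of l] by (metis (no_types, lifting) mem_Collect_eq not_le subsetI)
    have "V = (\<Union>l\<in>{..k}. {x\<in>V. c' x = l})"
      using c(1) by (auto simp: c'_def intro: less_imp_le)
    then have "card V \<le> (\<Sum>l\<le>k. card {x\<in>V. c' x = l})"
      using card_UN_le[of "{..k}" "\<lambda>l. {x\<in>V. c' x = l}"] by simp
    then have "(k + 1) * card V \<le> (\<Sum>l\<le>k. (k + 1) * card {x\<in>V. c' x = l})"
      unfolding sum_distrib_left[symmetric] by (rule mult_le_mono2)
    also have "\<dots> < (\<Sum>l\<le>k. card V)"
      by (intro sum_strict_mono) (use small in auto)
    finally show False by simp
  qed
qed

text \<open>The relations are treated one after another: a subset inherits both transitivity and the
  bound \<open>2 ^ k\<close>, so each relation costs the same factor \<open>k + 1\<close>.\<close>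

lemma ex_large_transp_on_subset_family:
  fixes f g :: "'i \<Rightarrow> 'a \<Rightarrow> 'b::linorder"
  assumes "finite I" "finite V" "card V < 2 ^ k"
  shows "\<exists>W\<subseteq>V. card V \<le> (k + 1) ^ card I * card W \<and>
           (\<forall>i\<in>I. transp_on W (\<lambda>x y. f i x < g i y))"
  using assms(1)
proof (induction I rule: finite_induct)
  case empty
  then show ?case by auto
next
  case (insert i I)
  then obtain W where W: "W \<subseteq> V" "card V \<le> (k + 1) ^ card I * card W"
      "\<forall>i\<in>I. transp_on W (\<lambda>x y. f i x < g i y)"
    by blast
  have "finite W" using W assms(2) finite_subset by blast
  moreover have "card W < 2 ^ k"
    using card_mono[OF assms(2) W(1)] assms(3) by simp
  ultimately obtain X where X: "X \<subseteq> W" "card W \<le> (k + 1) * card X"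
      "transp_on X (\<lambda>x y. f i x < g i y)"
    using ex_large_transp_on_subset[of W k "f i" "g i"] by blast
  have "card V \<le> (k + 1) ^ card I * ((k + 1) * card X)"
    using W(2) X(2) by (meson le_trans mult_le_mono2)
  also have "\<dots> = (k + 1) ^ card (insert i I) * card X"
    using insert.hyps by (simp del: add_Suc_right mult_Suc add: mult_ac)
  finally have "card V \<le> (k + 1) ^ card (insert i I) * card X" .
  moreover have "\<forall>j\<in>insert i I. transp_on X (\<lambda>x y. f j x < g j y)"
    using W(3) X(3) transp_on_subset[OF _ X(1)] by blast
  ultimately show ?case using W(1) X(1) by blast
qed

section \<open>Mirsky's theorem for transitive relations\<close>

text \<open>Peel off maximal elements: they form an antichain, and removing them shortens the
  longest chain by one. So \<open>m\<close> rounds, each removing at most \<open>s\<close> points,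
  exhaust \<open>V\<close>.\<close>

lemma mirsky_strict:
  assumes "finite V" "transp_on V D" "\<And>x. x \<in> V \<Longrightarrow> \<not> D x x"
    and "\<And>C. C \<subseteq> V \<Longrightarrow> totalp_on C D \<Longrightarrow> card C \<le> m"
  shows "\<exists>S\<subseteq>V. (\<forall>x\<in>S. \<forall>y\<in>S. \<not> D x y) \<and> card V \<le> m * card S"
proof -
  define s where "s = Max (card ` {S. S \<subseteq> V \<and> (\<forall>x\<in>S. \<forall>y\<in>S. \<not> D x y)})"
  let ?A = "{S. S \<subseteq> V \<and> (\<forall>x\<in>S. \<forall>y\<in>S. \<not> D x y)}"
  have finA: "finite (card ` ?A)" using assms(1) by simp
  have antichain: "card S \<le> s" if "S \<subseteq> V" "\<forall>x\<in>S. \<forall>y\<in>S. \<not> D x y" for S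
    unfolding s_def by (rule Max_ge[OF finA]) (use that in auto)
  have bound: "card U \<le> m * s" if "U \<subseteq> V"
    and "\<And>C. C \<subseteq> U \<Longrightarrow> totalp_on C D \<Longrightarrow> card C \<le> m" for U
    using that
  proof (induction m arbitrary: U)
    case 0
    have "U = {}"
    proof (rule ccontr)
      assume "U \<noteq> {}"
      then obtain x where "x \<in> U" by blast
      then show False using "0.prems"(2)[of "{x}"] by (simp add: totalp_on_def)
    qed
    then show ?case by simp
  next
    case (Suc m)
    define M where "M = {x\<in>U. \<forall>y\<in>U. \<not> D x y}"
    have finU: "finite U" using Suc.prems(1) assms(1) finite_subset by blast
    have "card (U - M) \<le> m * s"
    proof (rule Suc.IH)
      show "U - M \<subseteq> V" using Suc.prems(1) by blast
    next
      fix C assume C: "C \<subseteq> U - M" "totalp_on C D"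
      show "card C \<le> m"
      proof (cases "C = {}")
        case False
        have finC: "finite C" using C finU finite_subset by blast
        have CV: "C \<subseteq> V" using C Suc.prems(1) by blast
        have "\<exists>c\<in>C. \<forall>x\<in>C. x \<noteq> c \<longrightarrow> \<not> D c x"
        proof (rule Finite_Set.bex_max_element[OF finC _ _ False])
          show "asymp_on C D"
          proof (rule asymp_onI)
            fix x y assume "x \<in> C" "y \<in> C" "D x y"
            then show "\<not> D y x" using transp_onD[OF assms(2), of x y x] assms(3) CV by blast
          qed
          show "transp_on C D" using assms(2) CV by (rule transp_on_subset)
        qed
        then obtain c where c: "c \<in> C" "\<And>x. x \<in> C \<Longrightarrow> \<not> D c x"
          using assms(3) CV by (metis subsetD)
        have below: "D x c" if "x \<in> C" "x \<noteq> c" for x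
          using totalp_onD[OF C(2)] that c by blast
        \<comment> \<open>The top \<open>c\<close> of the chain was not peeled off, so some
          \<open>w\<close> in \<open>U\<close> lies above it and prolongs the chain by one
          element.\<close>
        obtain w where w: "w \<in> U" "D c w" using c C by (auto simp: M_def)
        have Dw: "D x w" if "x \<in> C" for x
          using below[OF that] w transp_onD[OF assms(2), of x c w] that c CV Suc.prems(1)
          by (cases "x = c") auto
        have "w \<notin> C" using c w by blast
        moreover have "totalp_on (insert w C) D"
          using C(2) Dw by (auto simp: totalp_on_def)
        then have "card (insert w C) \<le> Suc m"
          using Suc.prems(2) C w by blast
        ultimately show ?thesis using finC by simp
      qed simp
    qed
    moreover have "card M \<le> s"
      using antichain[of M] Suc.prems(1) by (auto simp: M_def)
    moreover have "card U = card (U - M) + card M"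
      using finU by (subst card_Un_disjoint[symmetric])
        (auto simp: M_def intro!: arg_cong[where f = card])
    ultimately show ?case by simp
  qed
  have "s \<in> card ` ?A"
    unfolding s_def by (rule Max_in[OF finA]) auto
  then obtain S where "S \<subseteq> V" "\<forall>x\<in>S. \<forall>y\<in>S. \<not> D x y" "card S = s" by auto
  then show ?thesis using bound[of V] assms(4) by blast
qed

text \<open>The relations to which this is applied are transitive but may contain loops and pairs
  related in both directions, so the strict version does not apply directly.\<close>

lemma mirsky:
  assumes fin: "finite V" and tr: "transp_on V D"
    and chain: "\<And>C. C \<subseteq> V \<Longrightarrow> totalp_on C D \<Longrightarrow> card C \<le> m"
  shows "\<exists>S\<subseteq>V. (\<forall>x\<in>S. \<forall>y\<in>S. x \<noteq> y \<longrightarrow> \<not> D x y) \<and> card V \<le> m * card S"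
proof -
  obtain h :: "'a \<Rightarrow> nat" where h: "inj_on h V"
    using finite_imp_inj_to_nat_seg[OF fin] by blast
  \<comment> \<open>Breaking ties along \<open>h\<close> keeps transitivity and the comparability of distinct elements.\<close>
  define D' where "D' x y \<longleftrightarrow> D x y \<and> (D y x \<longrightarrow> h x < h y)" for x y
  have "transp_on V D'"
  proof (rule transp_onI)
    fix x y z assume V: "x \<in> V" "y \<in> V" "z \<in> V" and "D' x y" "D' y z"
    then have xy: "D x y" "D y x \<Longrightarrow> h x < h y" and yz: "D y z" "D z y \<Longrightarrow> h y < h z"
      by (auto simp: D'_def)
    have "h x < h z" if zx: "D z x"
    proof -
      have "D z y" using transp_onD[OF tr, of z x y] V zx xy by blast
      moreover have "D y x" using transp_onD[OF tr, of y z x] V zx yz by blast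
      ultimately show ?thesis using xy yz by simp
    qed
    moreover have "D x z" using transp_onD[OF tr, of x y z] V xy yz by blast
    ultimately show "D' x z" by (simp add: D'_def)
  qed
  moreover have "\<not> D' x x" for x by (simp add: D'_def)
  moreover have "card C \<le> m" if "C \<subseteq> V" "totalp_on C D'" for C
    by (rule chain[OF that(1)]) (use that(2) in \<open>auto simp: totalp_on_def D'_def\<close>)
  ultimately obtain S where S: "S \<subseteq> V" "\<forall>x\<in>S. \<forall>y\<in>S. \<not> D' x y" "card V \<le> m * card S"
    using mirsky_strict[OF fin, of D' m] by blast
  have "\<not> D x y" if "x \<in> S" "y \<in> S" "x \<noteq> y" for x y
  proof -
    have "h x \<noteq> h y" using that S(1) h by (auto dest: inj_onD)
    then show ?thesis using that S(2) unfolding D'_def by (metis nat_neq_iff)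
  qed
  then show ?thesis using S by blast
qed

text \<open>An antichain of one relation stays an antichain in every subset, so the relations are
  handled in turn, each at the cost of a factor \<open>m\<close>.\<close>

lemma mirsky_family:
  fixes D :: "nat \<Rightarrow> 'a \<Rightarrow> 'a \<Rightarrow> bool"
  assumes fin: "finite V" and tr: "\<And>i. i < u \<Longrightarrow> transp_on V (D i)"
    and chain: "\<And>i C. i < u \<Longrightarrow> C \<subseteq> V \<Longrightarrow> totalp_on C (D i) \<Longrightarrow> card C \<le> m"
  shows "\<exists>S\<subseteq>V. (\<forall>i<u. \<forall>x\<in>S. \<forall>y\<in>S. x \<noteq> y \<longrightarrow> \<not> D i x y) \<and> card V \<le> m ^ u * card S"
  using tr chain
proof (induction u)
  case 0
  then show ?case by auto
next
  case (Suc u)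
  have "\<exists>S\<subseteq>V. (\<forall>i<u. \<forall>x\<in>S. \<forall>y\<in>S. x \<noteq> y \<longrightarrow> \<not> D i x y) \<and> card V \<le> m ^ u * card S"
    by (rule Suc.IH) (use Suc.prems less_SucI in blast)+
  then obtain S where S: "S \<subseteq> V" "\<forall>i<u. \<forall>x\<in>S. \<forall>y\<in>S. x \<noteq> y \<longrightarrow> \<not> D i x y"
      "card V \<le> m ^ u * card S"
    by blast
  obtain X where X: "X \<subseteq> S" "\<forall>x\<in>X. \<forall>y\<in>X. x \<noteq> y \<longrightarrow> \<not> D u x y" "card S \<le> m * card X"
  proof -
    have "finite S" using S(1) fin finite_subset by blast
    moreover have "transp_on S (D u)"
      using transp_on_subset[OF Suc.prems(1)[of u] S(1)] by simp
    moreover have "card C \<le> m" if "C \<subseteq> S" "totalp_on C (D u)" for C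
      by (rule Suc.prems(2)[of u]) (use that S(1) in auto)
    ultimately show thesis using mirsky[of S "D u" m] that by blast
  qed
  have "card V \<le> m ^ u * (m * card X)"
    using S(3) X(3) by (meson le_trans mult_le_mono2)
  then have "card V \<le> m ^ Suc u * card X" by (simp add: mult_ac)
  moreover have "\<forall>i<Suc u. \<forall>x\<in>X. \<forall>y\<in>X. x \<noteq> y \<longrightarrow> \<not> D i x y"
    using S(2) X(1,2) less_Suc_eq by blast
  moreover have "X \<subseteq> V" using S(1) X(1) by blast
  ultimately show ?case by (intro exI[of _ X] conjI)
qed

section \<open>Ramsey bound with a logarithmic factor\<close>

lemma semilinear_graph_ramsey:
  assumes G: "semilinear_graph t u d V A B" and card: "card V < 2 ^ k"
    and no: "\<not> has_clique_or_indep n (sl_edge t u d A B) V"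
  shows "card V \<le> (k + 1) ^ (t * u) * n ^ (u + 1)"
proof -
  have fin: "finite V" using G by (simp add: semilinear_graph_def)
  \<comment> \<open>Linear functions separate variables: the constant and the \<open>x\<close>-part
    form \<open>f\<close>, the negated \<open>y\<close>-part forms \<open>g\<close>, so negativity
    becomes \<open>f x < g y\<close>.\<close>
  define f where "f ij x = B (fst ij) (snd ij) + (\<Sum>k<d. A (fst ij) (snd ij) k * x k)"
    for ij and x :: "nat \<Rightarrow> real"
  define g where "g ij y = - (\<Sum>k<d. A (fst ij) (snd ij) (d + k) * y k)"
    for ij and y :: "nat \<Rightarrow> real"
  have lin: "lin_fun d (A i j) (B i j) x y < 0 \<longleftrightarrow> f (i, j) x < g (i, j) y" for i j x y
    by (auto simp: lin_fun_def f_def g_def)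
  define D where "D i x y \<longleftrightarrow> (\<forall>j<t. f (i, j) x < g (i, j) y)" for i x y
  have formula: "sl_formula t u d A B x y \<longleftrightarrow> (\<exists>i<u. D i x y)" for x y
    by (simp add: sl_formula_def lin D_def)
  obtain W where W: "W \<subseteq> V" "card V \<le> (k + 1) ^ (t * u) * card W"
      "\<forall>ij\<in>{..<u} \<times> {..<t}. transp_on W (\<lambda>x y. f ij x < g ij y)"
    using ex_large_transp_on_subset_family[of "{..<u} \<times> {..<t}" V k f g] fin card
    by (auto simp: card_cartesian_product mult.commute)
  have finW: "finite W" using W(1) fin finite_subset by blast
  \<comment> \<open>A homogeneous set of more than \<open>n\<close> vertices could be cut down to
    exactly \<open>n\<close>, the size that \<open>has_clique_or_indep\<close> asks for.\<close>
  have small: "card S \<le> n"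
    if "S \<subseteq> V" and homogeneous: "(\<forall>x\<in>S. \<forall>y\<in>S. x \<noteq> y \<longrightarrow> sl_edge t u d A B x y) \<or>
          (\<forall>x\<in>S. \<forall>y\<in>S. x \<noteq> y \<longrightarrow> \<not> sl_edge t u d A B x y)" for S
  proof (rule ccontr)
    assume "\<not> card S \<le> n"
    then obtain S' where S': "S' \<subseteq> S" "card S' = n"
      using obtain_subset_with_card_n[of n S] by auto
    have "(\<forall>x\<in>S'. \<forall>y\<in>S'. x \<noteq> y \<longrightarrow> sl_edge t u d A B x y) \<or>
          (\<forall>x\<in>S'. \<forall>y\<in>S'. x \<noteq> y \<longrightarrow> \<not> sl_edge t u d A B x y)"
      using homogeneous S'(1) by (auto dest: subsetD)
    moreover have "S' \<subseteq> V" using S'(1) that(1) by blast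
    ultimately show False
      using no S'(2) unfolding has_clique_or_indep_def by blast
  qed
  have "\<exists>S\<subseteq>W. (\<forall>i<u. \<forall>x\<in>S. \<forall>y\<in>S. x \<noteq> y \<longrightarrow> \<not> D i x y) \<and> card W \<le> n ^ u * card S"
  proof (rule mirsky_family[OF finW])
    fix i assume i: "i < u"
    show "transp_on W (D i)"
    proof (rule transp_onI)
      fix x y z assume xyz: "x \<in> W" "y \<in> W" "z \<in> W" "D i x y" "D i y z"
      have "f (i, j) x < g (i, j) z" if "j < t" for j
      proof -
        have "transp_on W (\<lambda>x y. f (i, j) x < g (i, j) y)" using W(3) i that by simp
        from transp_onD[OF this xyz(1-3)] show ?thesis using xyz(4,5) that by (simp add: D_def)
      qed
      then show "D i x z" by (simp add: D_def)
    qed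
    fix C assume C: "C \<subseteq> W" "totalp_on C (D i)"
    then have CV: "C \<subseteq> V" using W(1) by blast
    have "sl_edge t u d A B x y" if "x \<in> C" "y \<in> C" "x \<noteq> y" for x y
    proof -
      \<comment> \<open>Comparability gives the formula in one order only; its assumed symmetry
        makes the pair an edge.\<close>
      have "D i x y \<or> D i y x" using totalp_onD[OF C(2)] that by blast
      then have "sl_formula t u d A B x y \<or> sl_formula t u d A B y x"
        using formula i by blast
      then show ?thesis
        using G that CV unfolding semilinear_graph_def sl_edge_def by blast
    qed
    then show "card C \<le> n" using small CV by blast
  qed
  then obtain S where S: "S \<subseteq> W" "\<forall>i<u. \<forall>x\<in>S. \<forall>y\<in>S. x \<noteq> y \<longrightarrow> \<not> D i x y"
      "card W \<le> n ^ u * card S"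
    by blast
  have "card S \<le> n"
    by (rule small) (use S W(1) formula in \<open>auto simp: sl_edge_def\<close>)
  then have "card W \<le> n ^ u * n" using S(3) by (meson le_trans mult_le_mono2)
  then have "card V \<le> (k + 1) ^ (t * u) * (n ^ u * n)"
    using W(2) by (meson le_trans mult_le_mono2)
  then show ?thesis by (simp add: mult_ac)
qed

section \<open>Absorbing the logarithmic factor\<close>

text \<open>Take the \<open>m\<close>-th power of \<open>k \<le> m * 2 ^ (k div m)\<close> and use
  \<open>k div m * m \<le> k\<close>.\<close>

lemma power_le_const_mult_two_power:
  fixes k m :: nat
  assumes "0 < m"
  shows "k ^ m \<le> m ^ m * 2 ^ k"
proof -
  have "k = m * (k div m) + k mod m" by simp
  also have "\<dots> \<le> m * (k div m) + m"
    using assms by (intro add_left_mono less_imp_le) simp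
  also have "\<dots> = m * (k div m + 1)" by simp
  also have "\<dots> \<le> m * 2 ^ (k div m)"
    using less_exp[of "k div m"] by (intro mult_le_mono2) linarith
  finally have "k ^ m \<le> (m * 2 ^ (k div m)) ^ m" by (rule power_mono) simp
  also have "\<dots> = m ^ m * 2 ^ (k div m * m)" by (simp add: power_mult_distrib power_mult)
  also have "\<dots> \<le> m ^ m * 2 ^ k"
    by (intro mult_le_mono2 power_increasing) (use assms in auto)
  finally show ?thesis .
qed

lemma R_sl_le:
  assumes "0 < t" "0 < u"
  defines "q \<equiv> 2 * (t * u)"
  shows "R_sl t u n \<le> 4 * q ^ q * n ^ (2 * (u + 1)) + 1"
proof -
  \<comment> \<open>\<open>N\<close> exceeds by one the bound that a counterexample on
    \<open>N\<close> vertices would have to satisfy.\<close>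
  define N where "N = 4 * q ^ q * n ^ (2 * (u + 1)) + 1"
  have "has_clique_or_indep n (sl_edge t u d A B) V"
    if G: "semilinear_graph t u d V A B" and V: "card V = N" for d V A B
  proof (rule ccontr)
    assume no: "\<not> ?thesis"
    obtain j where j: "2 ^ j \<le> N" "N < 2 ^ (j + 1)"
      using ex_power_ivl1[of 2 N] by (auto simp: N_def)
    have "N \<le> (j + 2) ^ (t * u) * n ^ (u + 1)"
      using semilinear_graph_ramsey[OF G _ no, of "j + 1"] V j by simp
    \<comment> \<open>Squaring leaves a spare factor \<open>N\<close>. It pays for the logarithmic
      term: \<open>(j + 2) ^ q\<close> is at most \<open>q ^ q * 2 ^ (j + 2)\<close>, which is at
      most \<open>4 * q ^ q * N\<close> since \<open>2 ^ j \<le> N\<close>.\<close>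
    then have "N ^ 2 \<le> ((j + 2) ^ (t * u) * n ^ (u + 1)) ^ 2" by (rule power_mono) simp
    also have "\<dots> = (j + 2) ^ q * n ^ (2 * (u + 1))"
      by (simp only: power_mult_distrib power_mult[symmetric] q_def mult.commute)
    also have "\<dots> \<le> (q ^ q * 2 ^ (j + 2)) * n ^ (2 * (u + 1))"
      using power_le_const_mult_two_power[of q "j + 2"] assms by (intro mult_le_mono1) simp
    also have "\<dots> = 2 ^ j * (4 * q ^ q * n ^ (2 * (u + 1)))" by simp
    also have "\<dots> \<le> N * (4 * q ^ q * n ^ (2 * (u + 1)))"
      using j(1) by (rule mult_le_mono1)
    finally have "N \<le> 4 * q ^ q * n ^ (2 * (u + 1))"
      by (simp add: power2_eq_square N_def)
    then show False by (simp add: N_def)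
  qed
  then show ?thesis unfolding R_sl_def N_def by (intro Least_le) blast
qed

theorem theorem1p5:
  fixes u :: nat
  assumes "0 < u"
  shows "\<exists>\<beta>::real. \<beta> > 0 \<and> (\<forall>t::nat. 0 < t \<longrightarrow>
           (\<exists>\<alpha>::real. \<alpha> > 0 \<and> (\<forall>n::nat. 0 < n \<longrightarrow> real (R_sl t u n) \<le> \<alpha> * real n powr \<beta>)))"
\<comment> \<open>The exponent is fixed before \<open>t\<close> appears; \<open>t\<close> enters
  only through the constant \<open>c\<close>.\<close>
proof (rule exI[of _ "real (2 * (u + 1))"], intro conjI allI impI)
  show "0 < real (2 * (u + 1))" by simp
next
  fix t :: nat assume t: "0 < t"
  define c where "c = 4 * (2 * (t * u)) ^ (2 * (t * u))"
  have "real (R_sl t u n) \<le> real (c + 1) * real n powr real (2 * (u + 1))" if n: "0 < n" for n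
  proof -
    have "R_sl t u n \<le> c * n ^ (2 * (u + 1)) + 1"
      using R_sl_le[OF t assms, of n] by (simp add: c_def)
    \<comment> \<open>For positive \<open>n\<close> the additive 1 is at most the power of
      \<open>n\<close>.\<close>
    also have "\<dots> \<le> (c + 1) * n ^ (2 * (u + 1))" using n by simp
    finally have "real (R_sl t u n) \<le> real ((c + 1) * n ^ (2 * (u + 1)))"
      by (rule of_nat_mono)
    also have "\<dots> = real (c + 1) * real n powr real (2 * (u + 1))"
      using n powr_realpow[of "real n" "2 * (u + 1)"]
      by (simp only: of_nat_mult of_nat_power of_nat_0_less_iff)
    finally show ?thesis .
  qed
  then show "\<exists>\<alpha>::real. \<alpha> > 0 \<and>
      (\<forall>n::nat. 0 < n \<longrightarrow> real (R_sl t u n) \<le> \<alpha> * real n powr real (2 * (u + 1)))"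
    by (intro exI[of _ "real (c + 1)"]) auto
qed

end
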